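(* For every positive integer $m$ one has $$\sum_{k=0}^{2^n}(-1)^k(\xi_{k,n})^m=\frac12+O(n^{-1}),\qquad n\to\infty,$$ where $0=\xi_{0,n}<\xi_{1,n}<\dots<\xi_{2^n,n}=1$ are the elements of the $n$-th Stern-Brocot sequence $F_n$ in increasing order (the implied constant may depend on $m$).
   Context: Stern-Brocot sequences: $F_0=\{0/1,1/1\}$. If $F_n$ is written in increasing order as $0=\xi_{0,n}<\xi_{1,n}<\dots<\xi_{2^n,n}=1$ with $\xi_{j,n}=p_{j,n}/q_{j,n}$ in lowest terms, then $F_{n+1}=F_n\cup W_{n+1}$, where $W_{n+1}=\left\{\frac{p_{j,n}+p_{j+1,n}}{q_{j,n}+q_{j+1,n}}: j=0,\dots,2^n-1\right\}$. Thus $|F_n|=2^n+1$. *)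

theory Defs
  imports "HOL-Analysis.Analysis" "HOL-Library.Landau_Symbols"
begin

(* quotient_of gives the representation p/q in lowest terms with q > 0. *)
definition mediant :: "rat \<Rightarrow> rat \<Rightarrow> rat" where
  "mediant x y =
     Fract (fst (quotient_of x) + fst (quotient_of y)) (snd (quotient_of x) + snd (quotient_of y))"

primrec stern_brocot :: "nat \<Rightarrow> rat set" where
  "stern_brocot 0 = {0, 1}"
| "stern_brocot (Suc n) = stern_brocot n \<union>
     {mediant (sorted_list_of_set (stern_brocot n) ! j)
              (sorted_list_of_set (stern_brocot n) ! Suc j) | j. j < 2 ^ n}"

(* The j-th element of the n-th set in increasing order, counting from j = 0; meaningful only for
   j \<le> 2 ^ n, where the index is within the range of the list by card_stern_brocot below. *)
definition stern_brocot_elem :: "nat \<Rightarrow> nat \<Rightarrow> rat" where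
  "stern_brocot_elem n j = sorted_list_of_set (stern_brocot n) ! j"

lemma mediant_between:
  assumes "x < y"
  shows "x < mediant x y" "mediant x y < y"
proof -
  obtain a b where x: "quotient_of x = (a, b)" by fastforce
  obtain c d where y: "quotient_of y = (c, d)" by fastforce
  have b: "b > 0" and d: "d > 0"
    using x y quotient_of_denom_pos by blast+
  have xe: "x = Fract a b" and ye: "y = Fract c d"
    using x y quotient_of_div Fract_of_int_quotient by metis+
  have lt: "rat_of_int a / of_int b < of_int c / of_int d"
    using assms unfolding xe ye by (simp only: Fract_of_int_quotient)
  show "x < mediant x y" "mediant x y < y"
    using lt b d unfolding mediant_def x y
    by (simp_all add: xe ye Fract_of_int_quotient field_simps)
qed

lemma finite_stern_brocot [simp]: "finite (stern_brocot n)"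
  by (induction n) auto

lemma card_stern_brocot: "card (stern_brocot n) = 2 ^ n + 1"
proof (induction n)
  case 0
  show ?case by simp
next
  case (Suc n)
  define l where "l = sorted_list_of_set (stern_brocot n)"
  define f where "f j = mediant (l ! j) (l ! Suc j)" for j
  have len: "length l = 2 ^ n + 1"
    using Suc by (simp add: l_def)
  have setl: "set l = stern_brocot n"
    by (simp add: l_def)
  have mono: "l ! i < l ! j" if "i < j" "j < 2 ^ n + 1" for i j
    using that len by (simp add: l_def sorted_wrt_nth_less[OF strict_sorted_list_of_set])
  have f: "l ! j < f j" "f j < l ! Suc j" if "j < 2 ^ n" for j
    using mono[of j "Suc j"] that by (simp_all add: f_def mediant_between)
  have mono': "l ! i \<le> l ! j" if "i \<le> j" "j < 2 ^ n + 1" for i j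
    using mono[of i j] that by (cases "i = j") auto
  have less: "f i < f j" if "i < j" "j < 2 ^ n" for i j
    using f(2)[of i] f(1)[of j] mono'[of "Suc i" j] that by simp
  have "inj_on f {..<2 ^ n}"
    by (rule linorder_inj_onI) (auto dest: less)
  then have cardW: "card (f ` {..<2 ^ n}) = 2 ^ n"
    by (simp add: card_image)
  have "f j \<noteq> l ! i" if "j < 2 ^ n" "i < 2 ^ n + 1" for i j
    using f[of j] mono'[of i j] mono'[of "Suc j" i] that by (cases "i \<le> j") auto
  then have disj: "stern_brocot n \<inter> f ` {..<2 ^ n} = {}"
    unfolding setl[symmetric] using len by (auto simp: in_set_conv_nth) metis
  have "stern_brocot (Suc n) = stern_brocot n \<union> f ` {..<2 ^ n}"
    by (auto simp: f_def l_def)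
  then show ?case
    using Suc cardW disj by (simp add: card_Un_disjoint)
qed

end

theory Submission
  imports Defs
begin

text \<open>
  The maps \<open>x \<mapsto> x / (1 + x)\<close> and \<open>x \<mapsto> 1 / (2 - x)\<close> are induced by unimodular matrices, so they act
  linearly on numerator-denominator pairs and commute with the mediant. They send \<open>{0, 1}\<close> to
  \<open>{0, 1/2}\<close> and \<open>{1/2, 1}\<close>, hence the left and right half of the \<open>(n + 1)\<close>-st Stern-Brocot sequence are
  the images of the \<open>n\<close>-th (\<open>stern_brocot_elem_halves\<close>). Writing
  \<open>U f x = f (x / (1 + x)) + f (1 / (2 - x))\<close> for the operator \<open>farey_transfer\<close>,
  the alternating sums therefore satisfy \<open>S(n + 1, f) = S(n, U f) - f(1/2)\<close>, where the correction
  removes the point \<open>1/2\<close> that both halves share. Unrolling this gives the exact formula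
  \<open>S(n + 1, f) = (f 0 + f 1) / 2 + (g 0 + g 1) / 2 - g (1/2)\<close> with \<open>g = U\<^sup>n f\<close>
  (\<open>alternating_sum_eq\<close>). For a power the first term is \<open>1/2\<close>, and the rest is an error term.

  Since \<open>U\<close> commutes with the reflection \<open>x \<mapsto> 1 - x\<close>, the error is half of \<open>G 0 - G (1/2)\<close>, where
  \<open>G = U\<^sup>n F\<close> and \<open>F x = x\<^sup>m + (1 - x)\<^sup>m\<close> is symmetric and convex. The operator \<open>U\<close> preserves
  this class of functions (\<open>symmetric_convex_farey_transfer\<close>), so \<open>G\<close> is smallest at \<open>1/2\<close> and the error
  is nonnegative. The same minimality bounds it from above: as \<open>U h 0 = h 0 + h (1/2)\<close>, dropping the
  right branch gives \<open>U h 0 - U h x \<le> h 0 - h (x / (1 + x))\<close>. The \<open>n\<close>-fold iterate of the left branch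
  is \<open>x / (1 + n x)\<close>, which converges to its neutral fixed point 0 only at rate \<open>1 / n\<close>; this is the
  rate in the theorem: \<open>G 0 - G (1/2) \<le> F 0 - F (1 / (n + 2)) \<le> m / (n + 2)\<close>.
\<close>

section \<open>The two maps onto the halves of the unit interval\<close>

text \<open>
  The definitions are polymorphic because the maps act on the rationals, where mediants live, and on
  the reals, where convexity is used.
\<close>
definition farey_left :: "'a::field \<Rightarrow> 'a" where
  "farey_left x = x / (1 + x)"

definition farey_right :: "'a::field \<Rightarrow> 'a" where
  "farey_right x = 1 / (2 - x)"

lemma of_rat_farey:
  "(of_rat (farey_left x) :: real) = farey_left (of_rat x)"
  "(of_rat (farey_right x) :: real) = farey_right (of_rat x)"
  by (simp_all add: farey_left_def farey_right_def of_rat_divide of_rat_add of_rat_diff)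

lemma farey_left_bounds:
  fixes x :: "'a::linordered_field"
  assumes "0 \<le> x" "x \<le> 1"
  shows "0 \<le> farey_left x" "farey_left x \<le> 1 / 2"
  using assms by (simp_all add: farey_left_def field_simps)

lemma farey_right_bounds:
  fixes x :: "'a::linordered_field"
  assumes "0 \<le> x" "x \<le> 1"
  shows "1 / 2 \<le> farey_right x" "farey_right x \<le> 1"
  using assms by (simp_all add: farey_right_def field_simps)

lemma one_minus_farey_left:
  fixes x :: "'a::linordered_field"
  assumes "0 \<le> x"
  shows "1 - farey_left x = farey_right (1 - x)"
  using assms by (simp add: farey_left_def farey_right_def field_simps)

lemma quotient_of_Fract_coprime:
  assumes "b > 0" "coprime a b"
  shows "quotient_of (Fract a b) = (a, b)"
  using assms by (simp add: quotient_of_Fract normalize_stable)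

lemma farey_left_Fract:
  assumes "a \<ge> 0" "b > 0"
  shows "farey_left (Fract a b) = Fract a (a + b)"
proof -
  have "of_int (a + b) \<noteq> (0 :: rat)"
    using assms by (subst of_int_eq_0_iff) linarith
  then show ?thesis
    using assms by (simp add: farey_left_def Fract_of_int_quotient field_simps)
qed

lemma farey_right_Fract:
  assumes "a \<le> b" "b > 0"
  shows "farey_right (Fract a b) = Fract b (2 * b - a)"
proof -
  have "of_int (2 * b - a) \<noteq> (0 :: rat)"
    using assms by (subst of_int_eq_0_iff) linarith
  then show ?thesis
    using assms by (simp add: farey_right_def Fract_of_int_quotient field_simps)
qed

lemma quotient_of_FractE:
  obtains a b where "quotient_of x = (a, b)" "x = Fract a b" "b > 0" "coprime a b"
proof -
  obtain a b where q: "quotient_of x = (a, b)" by fastforce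
  then have "b > 0" "coprime a b" "x = Fract a b"
    using quotient_of_denom_pos quotient_of_coprime quotient_of_div Fract_of_int_quotient by metis+
  with q that show ?thesis by blast
qed

text \<open>
  The mediant is computed from reduced fractions, so it is essential that the two maps take a reduced
  pair \<open>(a, b)\<close> to the pairs \<open>(a, a + b)\<close> and \<open>(b, 2 b - a)\<close>, which are again reduced; on these pairs
  they are linear and so respect componentwise addition.
\<close>
lemma mediant_farey_left:
  assumes "x \<ge> 0" "y \<ge> 0"
  shows "mediant (farey_left x) (farey_left y) = farey_left (mediant x y)"
proof -
  obtain a b where x: "quotient_of x = (a, b)" "x = Fract a b" "b > 0" "coprime a b"
    by (rule quotient_of_FractE)
  have a: "a \<ge> 0"
    using assms(1) x(2,3) by (simp add: zero_le_Fract_iff)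
  obtain c d where y: "quotient_of y = (c, d)" "y = Fract c d" "d > 0" "coprime c d"
    by (rule quotient_of_FractE)
  have c: "c \<ge> 0"
    using assms(2) y(2,3) by (simp add: zero_le_Fract_iff)
  have "quotient_of (farey_left x) = (a, a + b)" "quotient_of (farey_left y) = (c, c + d)"
    unfolding x(2) y(2) using a x(3,4) c y(3,4)
    by (simp_all add: farey_left_Fract quotient_of_Fract_coprime coprime_iff_gcd_eq_1)
  then have "mediant (farey_left x) (farey_left y) = Fract (a + c) (a + c + (b + d))"
    by (simp add: mediant_def algebra_simps)
  also have "\<dots> = farey_left (mediant x y)"
    using a x(3) c y(3) by (simp add: mediant_def x(1) y(1) farey_left_Fract)
  finally show ?thesis .
qed

lemma mediant_farey_right:
  assumes "x \<le> 1" "y \<le> 1"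
  shows "mediant (farey_right x) (farey_right y) = farey_right (mediant x y)"
proof -
  have coprime: "coprime b (2 * b - a)" if "coprime a b" for a b :: int
  proof (rule coprimeI)
    fix c assume c: "c dvd b" "c dvd 2 * b - a"
    then have "c dvd 2 * b - (2 * b - a)"
      by (meson dvd_diff dvd_mult)
    then have "c dvd a" by simp
    then show "is_unit c"
      using c(1) that coprime_common_divisor by blast
  qed
  obtain a b where x: "quotient_of x = (a, b)" "x = Fract a b" "b > 0" "coprime a b"
    by (rule quotient_of_FractE)
  have a: "a \<le> b"
    using assms(1) x(2,3) by (simp add: Fract_le_one_iff)
  obtain c d where y: "quotient_of y = (c, d)" "y = Fract c d" "d > 0" "coprime c d"
    by (rule quotient_of_FractE)
  have c: "c \<le> d"
    using assms(2) y(2,3) by (simp add: Fract_le_one_iff)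
  have "quotient_of (farey_right x) = (b, 2 * b - a)" "quotient_of (farey_right y) = (d, 2 * d - c)"
    unfolding x(2) y(2) using a x(3,4) c y(3,4)
    by (simp_all add: farey_right_Fract quotient_of_Fract_coprime coprime)
  then have "mediant (farey_right x) (farey_right y) = Fract (b + d) (2 * (b + d) - (a + c))"
    by (simp add: mediant_def algebra_simps)
  also have "\<dots> = farey_right (mediant x y)"
    using a x(3) c y(3) by (simp add: mediant_def x(1) y(1) farey_right_Fract)
  finally show ?thesis .
qed

section \<open>Self-similarity of the Stern-Brocot sequence\<close>

text \<open>
  Elements of the sequences are defined by sorting; this turns any explicit increasing enumeration
  into a formula for them.
\<close>
lemma nth_sorted_list_of_set_eqI:
  fixes e :: "nat \<Rightarrow> 'a::linorder"
  assumes mono: "\<And>i. i < N \<Longrightarrow> e i < e (Suc i)" and img: "e ` {..N} = A" and k: "k \<le> N"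
  shows "sorted_list_of_set A ! k = e k"
proof -
  have less: "e i < e j" if "i < j" "j \<le> N" for i j
    using that
  proof (induction j)
    case (Suc j)
    then show ?case
      using mono[of j] by (cases "i = j") auto
  qed simp
  have "sorted_wrt (<) (map e [0..<Suc N])"
    by (auto simp: sorted_wrt_iff_nth_less less simp del: upt_Suc)
  moreover have "set (map e [0..<Suc N]) = A"
    using img by (auto simp: atMost_atLeast0 atLeastLessThanSuc_atLeastAtMost simp del: upt_Suc)
  ultimately have "sorted_list_of_set A = map e [0..<Suc N]"
    by (metis List.finite_set sorted_list_of_set.idem_if_sorted_distinct
        strict_sorted_iff)
  then show ?thesis
    using k by (simp del: upt_Suc)
qed

lemma stern_brocot_elem_less:
  assumes "j < 2 ^ n"
  shows "stern_brocot_elem n j < stern_brocot_elem n (Suc j)"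
  using assms card_stern_brocot[of n]
  by (simp add: stern_brocot_elem_def sorted_wrt_nth_less[OF strict_sorted_list_of_set])

lemma stern_brocot_eq_image: "stern_brocot n = stern_brocot_elem n ` {..2 ^ n}"
proof -
  have "stern_brocot n = set (sorted_list_of_set (stern_brocot n))"
    by simp
  also have "\<dots> = stern_brocot_elem n ` {..2 ^ n}"
    using card_stern_brocot[of n]
    by (subst set_conv_nth) (auto simp: stern_brocot_elem_def less_Suc_eq_le)
  finally show ?thesis .
qed

text \<open>
  Each mediant falls strictly between the two neighbours that produced it, so old and new elements
  alternate.
\<close>
lemma stern_brocot_elem_Suc:
  assumes "k \<le> 2 ^ Suc n"
  shows "stern_brocot_elem (Suc n) k =
    (if even k then stern_brocot_elem n (k div 2)
     else mediant (stern_brocot_elem n (k div 2)) (stern_brocot_elem n (Suc (k div 2))))"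
proof -
  define e where "e k =
    (if even k then stern_brocot_elem n (k div 2)
     else mediant (stern_brocot_elem n (k div 2)) (stern_brocot_elem n (Suc (k div 2))))" for k
  have "e i < e (Suc i)" if "i < 2 ^ Suc n" for i
    using that by (cases "even i") (auto simp: e_def elim!: evenE oddE
        intro!: mediant_between stern_brocot_elem_less)
  moreover have "e ` {..2 ^ Suc n} = stern_brocot (Suc n)"
  proof -
    have "{..2 ^ Suc n} = (\<lambda>i. 2 * i) ` {..2 ^ n} \<union> (\<lambda>i. Suc (2 * i)) ` {..<2 ^ n}"
    proof (intro equalityI subsetI)
      fix k :: nat
      assume "k \<in> {..2 ^ Suc n}"
      then show "k \<in> (\<lambda>i. 2 * i) ` {..2 ^ n} \<union> (\<lambda>i. Suc (2 * i)) ` {..<2 ^ n}"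
        by (cases "even k") (auto elim!: evenE oddE)
    qed auto
    then have "e ` {..2 ^ Suc n} = (\<lambda>i. e (2 * i)) ` {..2 ^ n} \<union> (\<lambda>i. e (Suc (2 * i))) ` {..<2 ^ n}"
      by (simp add: image_Un image_image)
    also have "(\<lambda>i. e (2 * i)) ` {..2 ^ n} = stern_brocot n"
      by (simp add: e_def stern_brocot_eq_image)
    also have "(\<lambda>i. e (Suc (2 * i))) ` {..<2 ^ n} =
        {mediant (stern_brocot_elem n j) (stern_brocot_elem n (Suc j)) | j. j < 2 ^ n}"
      by (auto simp: e_def)
    finally show ?thesis
      by (simp add: stern_brocot_elem_def)
  qed
  ultimately show ?thesis
    unfolding stern_brocot_elem_def[of "Suc n"] e_def[symmetric]
    using assms by (rule nth_sorted_list_of_set_eqI)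
qed

lemma stern_brocot_elem_0: "stern_brocot_elem 0 0 = 0" "stern_brocot_elem 0 (Suc 0) = 1"
  by (simp_all add: stern_brocot_elem_def)

lemma stern_brocot_elem_bounds:
  assumes "k \<le> 2 ^ n"
  shows "0 \<le> stern_brocot_elem n k \<and> stern_brocot_elem n k \<le> 1"
  using assms
proof (induction n arbitrary: k)
  case 0
  then show ?case
    by (cases k) (auto simp: stern_brocot_elem_0)
next
  case (Suc n)
  show ?case
  proof (cases "even k")
    case True
    with Suc show ?thesis
      by (auto simp: stern_brocot_elem_Suc)
  next
    case False
    with Suc.prems have lt: "k div 2 < 2 ^ n"
      by (auto elim!: oddE)
    show ?thesis
      using mediant_between[OF stern_brocot_elem_less[OF lt]] Suc.IH[of "k div 2"]
        Suc.IH[of "Suc (k div 2)"] lt Suc.prems False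
      by (auto simp: stern_brocot_elem_Suc)
  qed
qed

lemma stern_brocot_elem_endpoints:
  "stern_brocot_elem n 0 = 0" "stern_brocot_elem n (2 ^ n) = 1"
  by (induction n) (simp_all add: stern_brocot_elem_0 stern_brocot_elem_Suc)

text \<open>
  Self-similarity. A refinement step inserts mediants between neighbours, and both maps commute with
  mediants; so once the two halves of one level are images of the level before, this persists.
\<close>
lemma stern_brocot_elem_halves:
  assumes "k \<le> 2 ^ n"
  shows "stern_brocot_elem (Suc n) k = farey_left (stern_brocot_elem n k)
    \<and> stern_brocot_elem (Suc n) (2 ^ n + k) = farey_right (stern_brocot_elem n k)"
  using assms
proof (induction n arbitrary: k)
  case 0
  have "mediant 0 1 = 1 / 2"
    by (simp add: mediant_def Fract_of_int_quotient)
  moreover have "k = 0 \<or> k = Suc 0"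
    using 0 by auto
  ultimately show ?case
    by (auto simp: stern_brocot_elem_Suc stern_brocot_elem_0 farey_left_def farey_right_def)
next
  case (Suc n)
  show ?case
  proof (cases "even k")
    case True
    with Suc.prems have "k div 2 \<le> 2 ^ n"
      by auto
    with Suc True show ?thesis
      by (simp add: stern_brocot_elem_Suc[of _ "Suc n"] stern_brocot_elem_Suc[of k])
  next
    case False
    with Suc.prems have lt: "k div 2 < 2 ^ n"
      by (auto elim!: oddE)
    then have "(2 * 2 ^ n + k) div 2 = 2 ^ n + k div 2"
      by simp
    moreover have "k \<le> 2 * (2 * 2 ^ n)"
      using Suc.prems by simp
    ultimately show ?thesis
      using lt False Suc.prems Suc.IH[of "k div 2"] Suc.IH[of "Suc (k div 2)"]
        stern_brocot_elem_bounds[of "k div 2" n] stern_brocot_elem_bounds[of "Suc (k div 2)" n]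
      by (simp add: stern_brocot_elem_Suc[of _ "Suc n"] stern_brocot_elem_Suc[of k]
          mediant_farey_left mediant_farey_right)
  qed
qed

section \<open>Alternating sums and the transfer operator\<close>

definition farey_transfer :: "(real \<Rightarrow> real) \<Rightarrow> real \<Rightarrow> real" where
  "farey_transfer f x = f (farey_left x) + f (farey_right x)"

definition alternating_sum :: "nat \<Rightarrow> (real \<Rightarrow> real) \<Rightarrow> real" where
  "alternating_sum n f = (\<Sum>k=0..2 ^ n. (-1) ^ k * f (of_rat (stern_brocot_elem n k)))"

text \<open>
  For positive \<open>n\<close> the index \<open>2 ^ n\<close> at which the right half starts is even, so both halves carry the
  same signs. The shared point \<open>1/2\<close> is counted twice and has to be subtracted once.
\<close>
lemma alternating_sum_Suc:
  assumes "n > 0"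
  shows "alternating_sum (Suc n) f = alternating_sum n (farey_transfer f) - f (1 / 2)"
proof -
  define t where "t k = (-1) ^ k * f (of_rat (stern_brocot_elem (Suc n) k))" for k
  have ev: "even ((2::nat) ^ n)"
    using assms by simp
  have "alternating_sum (Suc n) f = sum t {0..2 ^ n + 2 ^ n}"
    by (simp add: alternating_sum_def t_def mult_2)
  also have "\<dots> = sum t {0..2 ^ n} + sum t {2 ^ n..2 ^ n + 2 ^ n} - t (2 ^ n)"
    using sum.ub_add_nat[of 0 "2 ^ n" t "2 ^ n"] sum.atLeast_Suc_atMost[of "2 ^ n" "2 ^ n + 2 ^ n" t]
    by simp
  also have "sum t {2 ^ n..2 ^ n + 2 ^ n} = (\<Sum>k=0..2 ^ n. t (2 ^ n + k))"
    using sum.shift_bounds_cl_nat_ivl[of t 0 "2 ^ n" "2 ^ n"] by (simp add: add.commute)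
  also have "sum t {0..2 ^ n} + (\<Sum>k=0..2 ^ n. t (2 ^ n + k))
      = alternating_sum n (farey_transfer f)"
    unfolding alternating_sum_def sum.distrib[symmetric]
    using ev by (intro sum.cong)
      (auto simp: t_def stern_brocot_elem_halves of_rat_farey farey_transfer_def power_add distrib_left)
  also have "t (2 ^ n) = f (1 / 2)"
  proof -
    have mid: "stern_brocot_elem (Suc n) (2 ^ n) = farey_left 1"
      using stern_brocot_elem_halves[of "2 ^ n" n] by (simp add: stern_brocot_elem_endpoints)
    have "f (of_rat (stern_brocot_elem (Suc n) (2 ^ n))) = f (1 / 2)"
      unfolding mid of_rat_farey by (simp add: farey_left_def)
    then show ?thesis
      using ev by (simp add: t_def)
  qed
  finally show ?thesis .
qed

text \<open>
  With \<open>U\<close> for the transfer operator, the telescoping comes from \<open>U f 0 + U f 1 = f 0 + f 1 + 2 f (1/2)\<close>: passing from \<open>f\<close> to \<open>U f\<close> raises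
  the trapezoidal term \<open>(f 0 + f 1) / 2\<close> by exactly the \<open>f (1/2)\<close> that the recursion subtracts.
\<close>
lemma alternating_sum_eq:
  "alternating_sum (Suc n) f = (f 0 + f 1) / 2
     + ((farey_transfer ^^ n) f 0 + (farey_transfer ^^ n) f 1) / 2 - (farey_transfer ^^ n) f (1 / 2)"
proof (induction n arbitrary: f)
  case 0
  have mid: "stern_brocot_elem (Suc 0) (Suc 0) = farey_left 1"
    using stern_brocot_elem_halves[of 1 0] by (simp add: stern_brocot_elem_0)
  have "f (of_rat (stern_brocot_elem (Suc 0) (Suc 0))) = f (1 / 2)"
    unfolding mid of_rat_farey by (simp add: farey_left_def)
  moreover have "stern_brocot_elem (Suc 0) (Suc (Suc 0)) = 1"
    using stern_brocot_elem_endpoints(2)[of "Suc 0"] by (simp add: numeral_2_eq_2)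
  ultimately show ?case
    by (simp add: alternating_sum_def stern_brocot_elem_endpoints numeral_2_eq_2 field_simps)
next
  case (Suc n)
  have "farey_transfer f 0 + farey_transfer f 1 = f 0 + f 1 + 2 * f (1 / 2)"
    by (simp add: farey_transfer_def farey_left_def farey_right_def)
  then show ?case
    by (simp add: alternating_sum_Suc Suc.IH funpow_Suc_right field_simps del: funpow.simps)
qed

text \<open>
  The reflection \<open>x \<mapsto> 1 - x\<close> exchanges the two branches, hence commutes with the operator. This allows
  a function to be symmetrised before it is iterated. On the unit interval the
  branches have no poles.
\<close>
lemma funpow_farey_transfer_reflect:
  assumes "0 \<le> x" "x \<le> 1"
  shows "(farey_transfer ^^ n) (\<lambda>t. f t + f (1 - t)) x
    = (farey_transfer ^^ n) f x + (farey_transfer ^^ n) f (1 - x)"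
  using assms
proof (induction n arbitrary: x)
  case (Suc n)
  have "1 - farey_left x = farey_right (1 - x)" "1 - farey_right x = farey_left (1 - x)"
    using one_minus_farey_left[of x] one_minus_farey_left[of "1 - x"] Suc.prems by auto
  then show ?case
    using Suc.prems farey_left_bounds[of x] farey_right_bounds[of x]
    by (simp add: farey_transfer_def[of "(farey_transfer ^^ n) _"] Suc.IH)
qed simp

section \<open>Symmetric convex functions\<close>

definition symmetric_convex :: "(real \<Rightarrow> real) \<Rightarrow> bool" where
  "symmetric_convex f \<longleftrightarrow> convex_on {0..1} f \<and> (\<forall>x\<in>{0..1}. f (1 - x) = f x)"

text \<open>
  If \<open>x \<le> y \<le> 1/2\<close>, then \<open>y\<close> lies between the mirror points \<open>x\<close> and \<open>1 - x\<close>, at which the function has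
  the same value.
\<close>
lemma symmetric_convex_antimono:
  assumes f: "symmetric_convex f" and xy: "0 \<le> x" "x \<le> y" "y \<le> 1 / 2"
  shows "f y \<le> f x"
proof (cases "x = y")
  case False
  \<comment> \<open>The weight with which \<open>y\<close> divides the segment from \<open>x\<close> to \<open>1 - x\<close>.\<close>
  define u where "u = (y - x) / (1 - 2 * x)"
  have u: "0 \<le> u" "u \<le> 1"
    using xy False by (auto simp: u_def field_simps)
  have "u * (1 - 2 * x) = y - x"
    using xy False by (simp add: u_def)
  then have y: "y = (1 - u) * x + u * (1 - x)"
    by (simp add: algebra_simps)
  have "f ((1 - u) * x + u * (1 - x)) \<le> (1 - u) * f x + u * f (1 - x)"
    using convex_onD[of "{0..1}" f u x "1 - x"] f u xy by (simp add: symmetric_convex_def)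
  also have "f (1 - x) = f x"
    using f xy by (simp add: symmetric_convex_def)
  finally show ?thesis
    unfolding y[symmetric] by (simp add: algebra_simps)
qed simp

lemma symmetric_convex_min:
  assumes f: "symmetric_convex f" and x: "0 \<le> x" "x \<le> 1"
  shows "f (1 / 2) \<le> f x"
proof (cases "x \<le> 1 / 2")
  case True
  then show ?thesis
    using symmetric_convex_antimono[OF f, of x "1 / 2"] x by simp
next
  case False
  then have "f (1 / 2) \<le> f (1 - x)"
    using symmetric_convex_antimono[OF f, of "1 - x" "1 / 2"] x by simp
  then show ?thesis
    using f x by (simp add: symmetric_convex_def)
qed

text \<open>
  Up to sign and a constant, the left branch is the convex function \<open>1 / (1 + x)\<close>.
\<close>
lemma farey_left_concave:
  fixes x y t :: real
  assumes "0 \<le> x" "0 \<le> y" "0 \<le> t" "t \<le> 1"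
  shows "(1 - t) * farey_left x + t * farey_left y \<le> farey_left ((1 - t) * x + t * y)"
proof -
  have eq: "farey_left z = 1 - inverse (1 + z)" if "0 \<le> z" for z :: real
    using that by (simp add: farey_left_def field_simps)
  have "inverse ((1 - t) * (1 + x) + t * (1 + y)) \<le> (1 - t) * inverse (1 + x) + t * inverse (1 + y)"
    using convex_onD[OF convex_on_inverse[of "{0<..}"], of t "1 + x" "1 + y"] assms by simp
  moreover have "(1 - t) * (1 + x) + t * (1 + y) = 1 + ((1 - t) * x + t * y)"
    by (simp add: algebra_simps)
  moreover have "0 \<le> (1 - t) * x + t * y"
    using assms by simp
  ultimately show ?thesis
    using assms by (simp add: eq right_diff_distrib)
qed

text \<open>
  On \<open>[0, 1/2]\<close> a symmetric convex function is decreasing and convex, so its composition with the concave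
  left branch is convex. By symmetry the right branch contributes the mirror image of that
  composition.
\<close>
lemma symmetric_convex_farey_transfer:
  assumes f: "symmetric_convex f"
  shows "symmetric_convex (farey_transfer f)"
proof -
  define h where "h x = f (farey_left x)" for x
  have transfer: "farey_transfer f x = h x + h (1 - x)" if "x \<in> {0..1}" for x
  proof -
    have "farey_right x = 1 - farey_left (1 - x)"
      using one_minus_farey_left[of "1 - x"] that by simp
    then show ?thesis
      using f that farey_left_bounds[of "1 - x"]
      by (simp add: farey_transfer_def h_def symmetric_convex_def)
  qed
  have h: "h ((1 - t) * x + t * y) \<le> (1 - t) * h x + t * h y"
    if "0 \<le> t" "t \<le> 1" "x \<in> {0..1}" "y \<in> {0..1}" for t x y
  proof -
    define a b where "a = farey_left x" and "b = farey_left y"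
    have ab: "0 \<le> a" "a \<le> 1 / 2" "0 \<le> b" "b \<le> 1 / 2"
      using that farey_left_bounds by (auto simp: a_def b_def)
    have "(1 - t) * x + t * y \<in> {0..1}"
      using convexD_alt[of "{0..1::real}" x y t] that by simp
    then have "farey_left ((1 - t) * x + t * y) \<le> 1 / 2"
      by (intro farey_left_bounds) auto
    moreover have "(1 - t) * a + t * b \<le> farey_left ((1 - t) * x + t * y)"
      using that unfolding a_def b_def by (intro farey_left_concave) auto
    ultimately have "f (farey_left ((1 - t) * x + t * y)) \<le> f ((1 - t) * a + t * b)"
      using that ab by (intro symmetric_convex_antimono[OF f]) auto
    also have "\<dots> \<le> (1 - t) * f a + t * f b"
      using convex_onD[of "{0..1}" f t a b] f that ab by (simp add: symmetric_convex_def)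
    finally show ?thesis
      by (simp add: h_def a_def b_def)
  qed
  have "convex_on {0..1} (farey_transfer f)"
  proof (rule convex_onI)
    fix t x y :: real
    assume t: "0 < t" "t < 1" and xy: "x \<in> {0..1}" "y \<in> {0..1}"
    have "(1 - t) * x + t * y \<in> {0..1}"
      using convexD_alt[of "{0..1::real}" x y t] t xy by simp
    moreover have "1 - ((1 - t) * x + t * y) = (1 - t) * (1 - x) + t * (1 - y)"
      by (simp add: algebra_simps)
    ultimately show "farey_transfer f ((1 - t) *\<^sub>R x + t *\<^sub>R y)
        \<le> (1 - t) * farey_transfer f x + t * farey_transfer f y"
      using h[of t x y] h[of t "1 - x" "1 - y"] t xy by (simp add: transfer algebra_simps)
  qed simp
  moreover have "farey_transfer f (1 - x) = farey_transfer f x" if "x \<in> {0..1}" for x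
    using that by (simp add: transfer)
  ultimately show ?thesis
    by (simp add: symmetric_convex_def)
qed

lemma symmetric_convex_funpow:
  "symmetric_convex f \<Longrightarrow> symmetric_convex ((farey_transfer ^^ n) f)"
  by (induction n) (auto intro: symmetric_convex_farey_transfer)

text \<open>
  In each step the right branch contributes \<open>f (1/2)\<close> at \<open>0\<close> and at least the minimum \<open>f (1/2)\<close> at any
  other point, so only the left branch can contribute to the drop, and its iterates are explicit.
\<close>
lemma funpow_farey_transfer_drop:
  assumes "symmetric_convex f" "0 \<le> x" "x \<le> 1"
  shows "(farey_transfer ^^ n) f 0 - (farey_transfer ^^ n) f x \<le> f 0 - f (x / (1 + real n * x))"
  using assms(1)
proof (induction n arbitrary: f)
  case (Suc n)
  define y where "y = x / (1 + real n * x)"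
  have pos: "1 + real n * x > 0"
    using assms by (simp add: add_pos_nonneg)
  have "x \<le> 1 + real n * x"
    using assms by (simp add: add_increasing2)
  then have y: "0 \<le> y" "y \<le> 1"
    using assms pos by (auto simp: y_def)
  have left: "farey_left y = x / (1 + real (Suc n) * x)"
  proof -
    have "1 + y = (1 + real (Suc n) * x) / (1 + real n * x)"
      using pos by (simp add: y_def field_simps)
    then show ?thesis
      using pos by (simp add: y_def farey_left_def)
  qed
  have "(farey_transfer ^^ Suc n) f 0 - (farey_transfer ^^ Suc n) f x
      \<le> farey_transfer f 0 - farey_transfer f y"
    using Suc.IH[OF symmetric_convex_farey_transfer[OF Suc.prems]]
    by (simp add: funpow_Suc_right y_def del: funpow.simps)
  also have "\<dots> = f 0 - f (farey_left y) + (f (1 / 2) - f (farey_right y))"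
    by (simp add: farey_transfer_def farey_left_def farey_right_def)
  also have "\<dots> \<le> f 0 - f (farey_left y)"
    using symmetric_convex_min[OF Suc.prems, of "farey_right y"] farey_right_bounds[OF y] by simp
  finally show ?case
    by (simp only: left)
qed simp

lemma convex_on_power_unit:
  "convex_on {0..1} (\<lambda>x::real. x ^ m)"
proof (induction m)
  case (Suc m)
  have "convex_on {0..1} (\<lambda>x::real. x * x ^ m)"
    by (rule convex_on_mul[OF _ Suc]) (auto simp: convex_on_ident mono_on_def power_mono)
  then show ?case by simp
qed (simp add: convex_on_const)

lemma symmetric_convex_power: "symmetric_convex (\<lambda>x. x ^ m + (1 - x) ^ m)"
proof -
  have "convex_on {0..1} (\<lambda>x::real. (1 - x) ^ m)"
  proof (rule convex_onI)
    fix t x y :: real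
    assume t: "0 < t" "t < 1" and xy: "x \<in> {0..1}" "y \<in> {0..1}"
    have "1 - ((1 - t) * x + t * y) = (1 - t) * (1 - x) + t * (1 - y)"
      by (simp add: algebra_simps)
    then show "(1 - ((1 - t) *\<^sub>R x + t *\<^sub>R y)) ^ m \<le> (1 - t) * (1 - x) ^ m + t * (1 - y) ^ m"
      using convex_onD[OF convex_on_power_unit, of t "1 - x" "1 - y" m] t xy by simp
  qed simp
  then have "convex_on {0..1} (\<lambda>x::real. x ^ m + (1 - x) ^ m)"
    by (intro convex_on_add convex_on_power_unit)
  then show ?thesis
    by (auto simp: symmetric_convex_def)
qed

text \<open>
  Starting at \<open>1/2\<close>, the left branch reaches \<open>u = 1 / (n + 2)\<close> after \<open>n\<close> steps, so the error is at most half
  the drop of \<open>x\<^sup>m + (1 - x)\<^sup>m\<close> between \<open>0\<close> and \<open>u\<close>, which Bernoulli's inequality bounds by \<open>m u\<close>.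
\<close>
lemma alternating_sum_power_bounds:
  assumes "m > 0"
  shows "\<bar>alternating_sum (Suc n) (\<lambda>x. x ^ m) - 1 / 2\<bar> \<le> real m / (2 * real (Suc n))"
proof -
  define f :: "real \<Rightarrow> real" where "f = (\<lambda>x. x ^ m)"
  define g where "g = (\<lambda>x. f x + f (1 - x))"
  define G where "G = (farey_transfer ^^ n) g"
  define u where "u = 1 / real (n + 2)"
  define C where "C = real m / real (Suc n)"
  have g: "symmetric_convex g"
    using symmetric_convex_power[of m] by (simp add: g_def f_def)
  have "G 0 = (farey_transfer ^^ n) f 0 + (farey_transfer ^^ n) f 1"
    "G (1 / 2) = 2 * (farey_transfer ^^ n) f (1 / 2)"
    using funpow_farey_transfer_reflect[of _ n f] by (simp_all add: G_def g_def)
  moreover have "f 0 + f 1 = 1"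
    using assms by (simp add: f_def)
  ultimately have "alternating_sum (Suc n) f - 1 / 2 = (G 0 - G (1 / 2)) / 2"
    by (simp add: alternating_sum_eq field_simps)
  moreover have "G (1 / 2) \<le> G 0"
    unfolding G_def using symmetric_convex_min[OF symmetric_convex_funpow[OF g], of 0] by simp
  moreover have "G 0 - G (1 / 2) \<le> C"
  proof -
    have "(1 / 2) / (1 + real n * (1 / 2)) = u"
      by (simp add: u_def field_simps)
    then have "G 0 - G (1 / 2) \<le> g 0 - g u"
      using funpow_farey_transfer_drop[OF g, of "1 / 2" n] by (simp add: G_def)
    also have "\<dots> \<le> 1 - (1 - u) ^ m"
      using assms by (simp add: g_def f_def u_def)
    also have "\<dots> \<le> real m * u"
      using Bernoulli_inequality[of "- u" m] by (simp add: u_def)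
    also have "\<dots> \<le> C"
      by (simp add: u_def C_def field_simps)
    finally show ?thesis .
  qed
  ultimately have "\<bar>alternating_sum (Suc n) f - 1 / 2\<bar> \<le> C / 2"
    by simp
  then show ?thesis
    by (simp add: f_def C_def mult.commute)
qed

theorem corollary3:
  fixes m :: nat
  assumes "m > 0"
  shows "(\<lambda>n::nat. (\<Sum>k=0..2 ^ n. (-1) ^ k * (of_rat (stern_brocot_elem n k) :: real) ^ m) - 1 / 2)
           \<in> O(\<lambda>n. 1 / real n)"
proof (rule landau_o.bigI[of "real m / 2"])
  show "\<forall>\<^sub>F n in at_top. norm ((\<Sum>k=0..2 ^ n. (-1) ^ k * (of_rat (stern_brocot_elem n k) :: real) ^ m) - 1 / 2)
      \<le> real m / 2 * norm (1 / real n)"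
    using eventually_gt_at_top[of 0]
  proof eventually_elim
    case (elim n)
    then obtain n' where n: "n = Suc n'"
      using gr0_conv_Suc by auto
    show ?case
      using alternating_sum_power_bounds[OF assms, of n'] unfolding n alternating_sum_def by simp
  qed
qed (use assms in simp)

end
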